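(* Let $R$ be a finite commutative ring with identity with Artin decomposition $R\simeq R_1\times\cdots\times R_s$, where each $R_i$ is a local ring with maximal ideal $\mathfrak{m}_i$ and residue field $R_i/\mathfrak{m}_i\simeq\mathbb{F}_{q_i}$, and let $k\in\mathbb{N}$ be such that $\gcd(k,|R|)=1$. Then $$\mathcal{G}_R(k)\simeq\Big(\bigotimes_{i=1}^s\mathcal{G}_{\mathbb{F}_{q_i}}(k)\Big)\otimes\mathring{K}_m\simeq\mathcal{G}_{R_{red}}(k)\otimes\mathring{K}_m\simeq\big(\mathcal{G}_{R_{red}}(k)\big)^{(m)},$$ where $R_{red}=\mathbb{F}_{q_1}\times\cdots\times\mathbb{F}_{q_s}$ and $m=|\mathfrak{m}_1|\cdots|\mathfrak{m}_s|$, if and only if there is at most one index $j\in\{1,\dots,s\}$ such that $-1\notin U_{R_j,k}$.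
   Context: For a commutative ring $R$ with identity and a positive integer $k$, $R^*$ is the group of units, $U_{R,k}=\{x^k:x\in R^*\}$ and $T_{R,k}=U_{R,k}\cup(-U_{R,k})$. For an abelian group $A$ and $S\subseteq A$ with $0\notin S$ and $S=-S$, $X(A,S)$ denotes the Cayley graph with vertex set $A$ and $v,w$ adjacent iff $w-v\in S$. The symmetrized $k$-th unitary Cayley graph is $\mathcal{G}_R(k)=X(R,T_{R,k})$. The Kronecker product $\Gamma_1\otimes\cdots\otimes\Gamma_s$ of graphs (loops allowed) has vertex set $V(\Gamma_1)\times\cdots\times V(\Gamma_s)$, with $(v_i)$ and $(w_i)$ adjacent iff $v_i$ and $w_i$ are adjacent in $\Gamma_i$ for every $i$. $\mathring{K}_m$ is the complete graph $K_m$ with a loop attached at each vertex. The balanced blow-up $\Gamma^{(m)}$ is obtained by replacing each vertex $x$ by a set $V_x$ of $m$ independent vertices and each edge $\{x,y\}$ by a complete bipartite graph $K_{m,m}$ with parts $V_x,V_y$. $\simeq$ between graphs denotes isomorphism. *)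

theory Defs
  imports
    "HOL-Algebra.Chinese_Remainder"
    "Graph_Theory.Pair_Digraph"
    "Graph_Theory.Digraph_Isomorphism"
begin

section \<open>Graphs\<close>

text \<open>
  An undirected graph without multiple edges, loops allowed, is represented by a
  \<^typ>\<open>'a pair_pre_digraph\<close> whose set of arcs is symmetric: an edge between \<open>x\<close> and \<open>y\<close>
  is the pair of arcs \<open>(x, y)\<close>, \<open>(y, x)\<close>, and a loop at \<open>x\<close> is the arc \<open>(x, x)\<close>.
\<close>

abbreviation graph_iso :: "'a pair_pre_digraph \<Rightarrow> 'b pair_pre_digraph \<Rightarrow> bool"
    (infix "\<simeq>\<^sub>g" 50) where
  "G \<simeq>\<^sub>g H \<equiv> digraph_iso (with_proj G) (with_proj H)"

lemma graph_iso_iff: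
  assumes G: "parcs G \<subseteq> pverts G \<times> pverts G" and H: "parcs H \<subseteq> pverts H \<times> pverts H"
  shows "G \<simeq>\<^sub>g H \<longleftrightarrow> (\<exists>f. bij_betw f (pverts G) (pverts H) \<and>
    (\<forall>x\<in>pverts G. \<forall>y\<in>pverts G. (x, y) \<in> parcs G \<longleftrightarrow> (f x, f y) \<in> parcs H))"
proof
  assume "G \<simeq>\<^sub>g H"
  then obtain h where h: "pre_digraph.digraph_isomorphism (with_proj G) h"
    and H_eq: "with_proj H = app_iso h (with_proj G)"
    unfolding digraph_iso_def by blast
  let ?f = "iso_verts h"
  have V: "pverts H = ?f ` pverts G" and E: "parcs H = iso_arcs h ` parcs G"
    and tl: "iso_tail h = fst" and hd: "iso_head h = snd"
    using H_eq by (simp_all add: with_proj_def app_iso_def)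
  have inj: "inj_on ?f (pverts G)"
    using h by (simp add: pre_digraph.digraph_isomorphism_def)
  have arc: "iso_arcs h a = (?f (fst a), ?f (snd a))" if "a \<in> parcs G" for a
    using h that tl hd by (simp add: pre_digraph.digraph_isomorphism_def prod_eq_iff)
  have "(x, y) \<in> parcs G \<longleftrightarrow> (?f x, ?f y) \<in> parcs H" if "x \<in> pverts G" "y \<in> pverts G" for x y
  proof
    assume "(x, y) \<in> parcs G"
    then show "(?f x, ?f y) \<in> parcs H"
      using arc E by force
  next
    assume "(?f x, ?f y) \<in> parcs H"
    then obtain a where a: "a \<in> parcs G" "(?f x, ?f y) = (?f (fst a), ?f (snd a))"
      using arc E by auto
    then have "fst a \<in> pverts G" "snd a \<in> pverts G" using G by auto
    then have "a = (x, y)" using a inj that by (auto simp: inj_on_def prod_eq_iff)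
    then show "(x, y) \<in> parcs G" using a by simp
  qed
  then show "\<exists>f. bij_betw f (pverts G) (pverts H) \<and>
      (\<forall>x\<in>pverts G. \<forall>y\<in>pverts G. (x, y) \<in> parcs G \<longleftrightarrow> (f x, f y) \<in> parcs H)"
    using inj V by (auto simp: bij_betw_def)
next
  assume "\<exists>f. bij_betw f (pverts G) (pverts H) \<and>
      (\<forall>x\<in>pverts G. \<forall>y\<in>pverts G. (x, y) \<in> parcs G \<longleftrightarrow> (f x, f y) \<in> parcs H)"
  then obtain f where f: "inj_on f (pverts G)" "pverts H = f ` pverts G"
    and adj: "\<And>x y. x \<in> pverts G \<Longrightarrow> y \<in> pverts G \<Longrightarrow> (x, y) \<in> parcs G \<longleftrightarrow> (f x, f y) \<in> parcs H"
    by (auto simp: bij_betw_def)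
  define h where "h = \<lparr>iso_verts = f, iso_arcs = map_prod f f, iso_head = snd, iso_tail = fst\<rparr>"
  have "inj_on (map_prod f f) (parcs G)"
    using map_prod_inj_on[OF f(1) f(1)] G by (rule inj_on_subset)
  moreover have "wf_digraph (with_proj G)"
    using G by unfold_locales auto
  ultimately have "pre_digraph.digraph_isomorphism (with_proj G) h"
    using f by (auto simp: pre_digraph.digraph_isomorphism_def h_def)
  moreover have "parcs H = map_prod f f ` parcs G"
  proof (intro equalityI subsetI)
    fix b assume b: "b \<in> parcs H"
    then have "fst b \<in> f ` pverts G" "snd b \<in> f ` pverts G" using H f(2) by auto
    then obtain x y where "x \<in> pverts G" "y \<in> pverts G" "b = (f x, f y)"
      by (auto simp: prod_eq_iff)
    then show "b \<in> map_prod f f ` parcs G" using b adj by force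
  next
    fix b assume "b \<in> map_prod f f ` parcs G"
    then show "b \<in> parcs H" using adj G by auto
  qed
  then have "with_proj H = app_iso h (with_proj G)"
    using f by (simp add: with_proj_def app_iso_def h_def)
  ultimately show "G \<simeq>\<^sub>g H" unfolding digraph_iso_def by blast
qed

definition kronecker_family :: "'i set \<Rightarrow> ('i \<Rightarrow> 'a pair_pre_digraph) \<Rightarrow> ('i \<Rightarrow> 'a) pair_pre_digraph" where
  "kronecker_family I \<Gamma> =
    \<lparr>pverts = (\<Pi>\<^sub>E i\<in>I. pverts (\<Gamma> i)),
     parcs = {(v, w). v \<in> (\<Pi>\<^sub>E i\<in>I. pverts (\<Gamma> i)) \<and> w \<in> (\<Pi>\<^sub>E i\<in>I. pverts (\<Gamma> i)) \<and>
                      (\<forall>i\<in>I. (v i, w i) \<in> parcs (\<Gamma> i))}\<rparr>"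

definition kronecker :: "'a pair_pre_digraph \<Rightarrow> 'b pair_pre_digraph \<Rightarrow> ('a \<times> 'b) pair_pre_digraph"
    (infixr "\<otimes>\<^sub>g" 70) where
  "\<Gamma> \<otimes>\<^sub>g \<Delta> =
    \<lparr>pverts = pverts \<Gamma> \<times> pverts \<Delta>,
     parcs = {((v1, v2), (w1, w2)). (v1, w1) \<in> parcs \<Gamma> \<and> (v2, w2) \<in> parcs \<Delta>}\<rparr>"

definition complete_graph :: "nat \<Rightarrow> nat pair_pre_digraph" where
  "complete_graph m = \<lparr>pverts = {..<m}, parcs = {(i, j). i < m \<and> j < m \<and> i \<noteq> j}\<rparr>"

definition add_loops :: "'a pair_pre_digraph \<Rightarrow> 'a pair_pre_digraph" where
  "add_loops \<Gamma> = \<Gamma>\<lparr>parcs := parcs \<Gamma> \<union> Id_on (pverts \<Gamma>)\<rparr>"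

text \<open>The independent set replacing a vertex \<open>x\<close> is \<open>{x} \<times> {..<m}\<close>.\<close>

definition blow_up :: "'a pair_pre_digraph \<Rightarrow> nat \<Rightarrow> ('a \<times> nat) pair_pre_digraph" where
  "blow_up \<Gamma> m =
    \<lparr>pverts = pverts \<Gamma> \<times> {..<m},
     parcs = {((x, i), (y, j)). (x, y) \<in> parcs \<Gamma> \<and> i < m \<and> j < m}\<rparr>"

text \<open>
  The group is written multiplicatively in HOL-Algebra, so \<open>w - v\<close> is \<open>w \<otimes> inv v\<close>.
  The graph is undirected and loopless when \<open>S\<close> is closed under inverses and omits
  the neutral element.
\<close>

definition cayley_graph :: "('a, 'm) monoid_scheme \<Rightarrow> 'a set \<Rightarrow> 'a pair_pre_digraph" where
  "cayley_graph A S =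
    \<lparr>pverts = carrier A,
     parcs = {(v, w). v \<in> carrier A \<and> w \<in> carrier A \<and> w \<otimes>\<^bsub>A\<^esub> inv\<^bsub>A\<^esub> v \<in> S}\<rparr>"


section \<open>Rings and unitary Cayley graphs\<close>

definition local_ring :: "('a, 'm) ring_scheme \<Rightarrow> bool" where
  "local_ring R \<longleftrightarrow> cring R \<and> (\<exists>!I. maximalideal I R)"

definition unit_powers :: "('a, 'm) ring_scheme \<Rightarrow> nat \<Rightarrow> 'a set" where
  "unit_powers R k = {x [^]\<^bsub>R\<^esub> k | x. x \<in> Units R}"

definition sym_unit_powers :: "('a, 'm) ring_scheme \<Rightarrow> nat \<Rightarrow> 'a set" where
  "sym_unit_powers R k = unit_powers R k \<union> {\<ominus>\<^bsub>R\<^esub> x | x. x \<in> unit_powers R k}"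

definition unitary_cayley :: "('a, 'm) ring_scheme \<Rightarrow> nat \<Rightarrow> 'a pair_pre_digraph" where
  "unitary_cayley R k = cayley_graph (add_monoid R) (sym_unit_powers R k)"

lemma sym_unit_powers_uminus:
  assumes "cring R" and "x \<in> sym_unit_powers R k"
  shows "\<ominus>\<^bsub>R\<^esub> x \<in> sym_unit_powers R k"
proof -
  interpret cring R by fact
  have "unit_powers R k \<subseteq> carrier R"
    by (auto simp: unit_powers_def)
  then show ?thesis
    using assms(2) unfolding sym_unit_powers_def by (auto simp: subset_iff)
qed

lemma zero_notin_sym_unit_powers:
  assumes "cring R" and "\<one>\<^bsub>R\<^esub> \<noteq> \<zero>\<^bsub>R\<^esub>"
  shows "\<zero>\<^bsub>R\<^esub> \<notin> sym_unit_powers R k"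
proof -
  interpret cring R by fact
  have zero: "\<zero>\<^bsub>R\<^esub> \<notin> Units R"
    using assms(2) by (auto simp: Units_def)
  have U: "unit_powers R k \<subseteq> Units R"
  proof (clarsimp simp: unit_powers_def)
    fix x assume x: "x \<in> Units R"
    show "x [^]\<^bsub>R\<^esub> k \<in> Units R"
      by (induction k) (use x in auto)
  qed
  show ?thesis
  proof
    assume "\<zero>\<^bsub>R\<^esub> \<in> sym_unit_powers R k"
    then consider "\<zero>\<^bsub>R\<^esub> \<in> unit_powers R k"
      | x where "x \<in> unit_powers R k" "\<ominus>\<^bsub>R\<^esub> x = \<zero>\<^bsub>R\<^esub>"
      by (auto simp: sym_unit_powers_def)
    then show False
    proof cases
      case 2
      then have "x \<in> carrier R" using U by auto
      then have "x = \<zero>\<^bsub>R\<^esub>" using 2(2) by (metis minus_minus minus_zero)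
      then show False using 2(1) U zero by auto
    qed (use U zero in auto)
  qed
qed

end

theory Submission
  imports Defs "HOL-Algebra.Multiplicative_Group" "HOL-Number_Theory.Cong"
begin

text \<open>
  Write \<open>\<phi> i\<close> for the homomorphism from \<open>R\<close> to the \<open>i\<close>-th residue field \<open>F i\<close>. Since \<open>k\<close> is
  coprime to \<open>|R|\<close>, being a \<open>k\<close>-th power of a unit can be read off from the residues: in a local
  factor with maximal ideal \<open>M\<close>, the residue of \<open>x\<close> is the \<open>k\<close>-th power of a unit iff \<open>x\<close> is a
  \<open>k\<close>-th power up to an element of \<open>1 + M\<close>, and \<open>1 + M\<close> is a group of order \<open>|M|\<close>, so each of its
  elements is a \<open>k\<close>-th power itself (lemma \<open>one_unit_is_power\<close>). Hence \<open>x\<close> lies in \<open>U_{R,k}\<close> iff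
  all \<open>\<phi> i x\<close> lie in \<open>U_{F i,k}\<close>; the locale \<open>power_detecting_family\<close> records this situation.

  Compare \<open>T_{R,k}\<close> with the set \<open>T'\<close> of all \<open>x\<close> such that every \<open>\<phi> i x\<close> lies in \<open>T_{F i,k}\<close>.
  In the Cayley graph of \<open>R\<close> with connection set \<open>T'\<close> adjacency depends on residues only, and it is
  adjacency in the Kronecker product of the graphs of the \<open>F i\<close>. As every tuple of residues comes
  from exactly \<open>m\<close> elements of \<open>R\<close>, this Cayley graph is, whatever the signs, the balanced blow-up
  of order \<open>m\<close> of that Kronecker product
  (lemma \<open>componentwise_cayley_iso_blow_up\<close>).

  One always has \<open>T_{R,k} \<subseteq> T'\<close>. Elements of \<open>T'\<close> choose a sign in each component independently,
  those of \<open>T_{R,k}\<close> choose one sign for all components. The two sets agree when at most one component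
  sees the sign, that is, when \<open>-1\<close> fails to be a \<open>k\<close>-th power in at most one \<open>F i\<close>. If there are two
  such components, then \<open>T_{R,k}\<close> is strictly smaller, the graph of \<open>R\<close> has strictly fewer
  arcs than the blow-up, and the two finite graphs are not isomorphic.

  The reduced ring has the same residue fields and is the case \<open>m = 1\<close> of this argument. The
  remaining isomorphism, between the product with a looped complete graph and the blow-up, is an
  equality of the two representations.
\<close>


section \<open>Graph isomorphisms and blow-ups\<close>

lemma graph_iso_refl: "G \<simeq>\<^sub>g G" if "parcs G \<subseteq> pverts G \<times> pverts G"
  using that by (subst graph_iso_iff) (auto intro!: exI[of _ id])

lemma graph_iso_sym:
  assumes "parcs G \<subseteq> pverts G \<times> pverts G" and "G \<simeq>\<^sub>g H"
  shows "H \<simeq>\<^sub>g G"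
proof (rule digraph_iso_swap)
  show "wf_digraph (with_proj G)"
    using assms(1) by unfold_locales auto
qed (fact assms(2))

lemma graph_iso_card_parcs:
  assumes "parcs G \<subseteq> pverts G \<times> pverts G" and "parcs H \<subseteq> pverts H \<times> pverts H"
    and "G \<simeq>\<^sub>g H"
  shows "card (parcs G) = card (parcs H)"
proof -
  obtain f where f: "bij_betw f (pverts G) (pverts H)"
    and adj: "\<And>x y. x \<in> pverts G \<Longrightarrow> y \<in> pverts G \<Longrightarrow>
      (x, y) \<in> parcs G \<longleftrightarrow> (f x, f y) \<in> parcs H"
    using assms by (auto simp: graph_iso_iff)
  have "inj_on (map_prod f f) (parcs G)"
    using map_prod_inj_on[of f "pverts G" f "pverts G"] f assms(1)
    by (meson bij_betw_def inj_on_subset)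
  moreover have "map_prod f f ` parcs G = parcs H"
  proof (intro equalityI subsetI)
    fix b assume b: "b \<in> parcs H"
    then have "fst b \<in> f ` pverts G" "snd b \<in> f ` pverts G"
      using assms(2) f by (auto simp: bij_betw_def)
    then obtain x y where "x \<in> pverts G" "y \<in> pverts G" "b = (f x, f y)"
      by (auto simp: prod_eq_iff)
    then show "b \<in> map_prod f f ` parcs G"
      using b adj by force
  qed (use adj assms(1) in auto)
  ultimately show ?thesis
    by (metis card_image)
qed

lemma parcs_blow_up_subset:
  assumes "parcs \<Delta> \<subseteq> pverts \<Delta> \<times> pverts \<Delta>"
  shows "parcs (blow_up \<Delta> m) \<subseteq> pverts (blow_up \<Delta> m) \<times> pverts (blow_up \<Delta> m)"
  using assms by (auto simp: blow_up_def)

text \<open>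
  All pairs of vertices of the looped complete graph are arcs, so its factor imposes no condition
  on adjacency.
\<close>

lemma kronecker_looped_complete_eq_blow_up:
  "\<Gamma> \<otimes>\<^sub>g add_loops (complete_graph m) = blow_up \<Gamma> m"
  by (auto simp: kronecker_def add_loops_def complete_graph_def blow_up_def)

text \<open>
  Recognition of blow-ups: numbering the \<open>m\<close> elements of each fibre of \<open>\<Phi>\<close> supplies the second
  coordinate of an isomorphism whose first coordinate is \<open>\<Phi>\<close>.
\<close>

lemma graph_iso_blow_up_of_fibres:
  assumes \<Gamma>: "parcs \<Gamma> \<subseteq> pverts \<Gamma> \<times> pverts \<Gamma>" and \<Delta>: "parcs \<Delta> \<subseteq> pverts \<Delta> \<times> pverts \<Delta>"
    and \<Phi>: "\<And>x. x \<in> pverts \<Gamma> \<Longrightarrow> \<Phi> x \<in> pverts \<Delta>"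
    and fibres: "\<And>u. u \<in> pverts \<Delta> \<Longrightarrow> card {x \<in> pverts \<Gamma>. \<Phi> x = u} = m"
    and "m > 0"
    and adj: "\<And>x y. x \<in> pverts \<Gamma> \<Longrightarrow> y \<in> pverts \<Gamma> \<Longrightarrow>
      (x, y) \<in> parcs \<Gamma> \<longleftrightarrow> (\<Phi> x, \<Phi> y) \<in> parcs \<Delta>"
  shows "\<Gamma> \<simeq>\<^sub>g blow_up \<Delta> m"
proof -
  define fib where "fib u = {x \<in> pverts \<Gamma>. \<Phi> x = u}" for u
  have "\<exists>e. bij_betw e (fib u) {..<m}" if "u \<in> pverts \<Delta>" for u
  proof -
    have "finite (fib u)"
      using fibres[OF that] \<open>m > 0\<close> by (auto simp: fib_def intro: card_ge_0_finite)
    then show ?thesis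
      using ex_bij_betw_finite_nat[of "fib u"] fibres[OF that]
      by (auto simp: fib_def atLeast0LessThan)
  qed
  then obtain e where e: "\<And>u. u \<in> pverts \<Delta> \<Longrightarrow> bij_betw (e u) (fib u) {..<m}"
    by metis
  define f where "f x = (\<Phi> x, e (\<Phi> x) x)" for x
  have e_lt: "e (\<Phi> x) x < m" if "x \<in> pverts \<Gamma>" for x
    using bij_betwE[OF e[OF \<Phi>[OF that]]] that by (auto simp: fib_def)
  have "bij_betw f (pverts \<Gamma>) (pverts \<Delta> \<times> {..<m})"
  proof (rule bij_betw_imageI)
    show "inj_on f (pverts \<Gamma>)"
    proof (rule inj_onI)
      fix x y assume x: "x \<in> pverts \<Gamma>" and y: "y \<in> pverts \<Gamma>" and "f x = f y"
      then have "\<Phi> y = \<Phi> x" "e (\<Phi> x) x = e (\<Phi> x) y"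
        by (auto simp: f_def)
      moreover have "inj_on (e (\<Phi> x)) (fib (\<Phi> x))"
        using e[OF \<Phi>[OF x]] by (simp add: bij_betw_def)
      ultimately show "x = y"
        using x y by (auto simp: inj_on_def fib_def)
    qed
    show "f ` pverts \<Gamma> = pverts \<Delta> \<times> {..<m}"
    proof (intro equalityI subsetI)
      fix b assume "b \<in> pverts \<Delta> \<times> {..<m}"
      then obtain u i where b: "b = (u, i)" "u \<in> pverts \<Delta>" "i < m" by auto
      then obtain x where "x \<in> fib u" "e u x = i"
        using e[OF b(2)] unfolding bij_betw_def by (metis imageE lessThan_iff)
      then show "b \<in> f ` pverts \<Gamma>"
        using b by (auto simp: f_def fib_def)
    qed (use \<Phi> e_lt in \<open>auto simp: f_def\<close>)
  qed
  moreover have "(x, y) \<in> parcs \<Gamma> \<longleftrightarrow> (f x, f y) \<in> parcs (blow_up \<Delta> m)"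
    if "x \<in> pverts \<Gamma>" "y \<in> pverts \<Gamma>" for x y
    using adj[OF that] e_lt that by (auto simp: blow_up_def f_def)
  ultimately show ?thesis
    using \<Gamma> parcs_blow_up_subset[OF \<Delta>]
    by (subst graph_iso_iff) (auto simp: blow_up_def)
qed

lemma blow_up_one_iso:
  assumes "parcs \<Delta> \<subseteq> pverts \<Delta> \<times> pverts \<Delta>"
  shows "\<Delta> \<simeq>\<^sub>g blow_up \<Delta> 1"
proof -
  have "bij_betw (\<lambda>x. (x, 0::nat)) (pverts \<Delta>) (pverts (blow_up \<Delta> 1))"
    by (auto simp: blow_up_def bij_betw_def inj_on_def)
  then show ?thesis
    using assms parcs_blow_up_subset[OF assms]
    by (subst graph_iso_iff) (auto simp: blow_up_def)
qed

lemma blow_up_cong: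
  assumes \<Gamma>: "parcs \<Gamma> \<subseteq> pverts \<Gamma> \<times> pverts \<Gamma>" and \<Delta>: "parcs \<Delta> \<subseteq> pverts \<Delta> \<times> pverts \<Delta>"
    and "\<Gamma> \<simeq>\<^sub>g \<Delta>"
  shows "blow_up \<Gamma> m \<simeq>\<^sub>g blow_up \<Delta> m"
proof -
  obtain f where f: "bij_betw f (pverts \<Gamma>) (pverts \<Delta>)"
    and adj: "\<And>x y. x \<in> pverts \<Gamma> \<Longrightarrow> y \<in> pverts \<Gamma> \<Longrightarrow>
      (x, y) \<in> parcs \<Gamma> \<longleftrightarrow> (f x, f y) \<in> parcs \<Delta>"
    using assms by (auto simp: graph_iso_iff)
  have "bij_betw (map_prod f id) (pverts \<Gamma> \<times> {..<m}) (pverts \<Delta> \<times> {..<m})"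
    using f by (intro bij_betw_map_prod) auto
  then show ?thesis
    using adj parcs_blow_up_subset[OF \<Gamma>] parcs_blow_up_subset[OF \<Delta>]
    by (subst graph_iso_iff) (auto simp: blow_up_def intro!: exI[of _ "map_prod f id"])
qed


section \<open>Powers of units\<close>

lemma ring_hom_Units:
  assumes "ring_hom_ring R S h" and "x \<in> Units R"
  shows "h x \<in> Units S"
proof -
  interpret ring_hom_ring R S h by fact
  have "h (inv\<^bsub>R\<^esub> x) \<otimes>\<^bsub>S\<^esub> h x = \<one>\<^bsub>S\<^esub>" "h x \<otimes>\<^bsub>S\<^esub> h (inv\<^bsub>R\<^esub> x) = \<one>\<^bsub>S\<^esub>"
    using assms(2) by (simp_all flip: hom_mult add: R.Units_closed)
  then show ?thesis
    using assms(2) unfolding Units_def[of S] by (auto intro!: bexI[of _ "h (inv\<^bsub>R\<^esub> x)"])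
qed

lemma ring_hom_pow:
  assumes "ring_hom_ring R S h" and "x \<in> carrier R"
  shows "h (x [^]\<^bsub>R\<^esub> (n::nat)) = h x [^]\<^bsub>S\<^esub> n"
proof -
  interpret ring_hom_ring R S h by fact
  show ?thesis
    using assms(2) by (induction n) auto
qed

lemma ring_hom_unit_powers:
  assumes "ring_hom_ring R S h" and "x \<in> unit_powers R k"
  shows "h x \<in> unit_powers S k"
proof -
  interpret ring_hom_ring R S h by fact
  show ?thesis
    using assms(2) ring_hom_Units[OF assms(1)] ring_hom_pow[OF assms(1)]
    unfolding unit_powers_def by blast
qed

lemma (in ring) unit_powers_closed: "x \<in> unit_powers R k \<Longrightarrow> x \<in> carrier R"
  by (auto simp: unit_powers_def)

lemma (in ring) one_in_unit_powers: "\<one> \<in> unit_powers R k"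
  by (auto simp: unit_powers_def intro!: exI[of _ \<one>])

lemma (in ring) sym_unit_powers_iff:
  "x \<in> carrier R \<Longrightarrow> x \<in> sym_unit_powers R k \<longleftrightarrow> x \<in> unit_powers R k \<or> \<ominus> x \<in> unit_powers R k"
  unfolding sym_unit_powers_def using unit_powers_closed
  by (auto simp: minus_equality)

lemma (in cring) minus_in_unit_powers:
  assumes "\<ominus> \<one> \<in> unit_powers R k" and "x \<in> unit_powers R k"
  shows "\<ominus> x \<in> unit_powers R k"
proof -
  obtain a b where a: "a \<in> Units R" "\<ominus> \<one> = a [^] k" and b: "b \<in> Units R" "x = b [^] k"
    using assms by (auto simp: unit_powers_def)
  have "\<ominus> x = \<ominus> \<one> \<otimes> x"
    using assms(2) by (simp add: unit_powers_closed l_minus)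
  also have "\<dots> = (a \<otimes> b) [^] k"
    using a b by (simp add: nat_pow_distrib Units_closed)
  finally show ?thesis
    using a b unfolding unit_powers_def by blast
qed

lemma parcs_cayley_add_monoid:
  assumes "ring R"
  shows "(v, w) \<in> parcs (cayley_graph (add_monoid R) T) \<longleftrightarrow>
    v \<in> carrier R \<and> w \<in> carrier R \<and> w \<ominus>\<^bsub>R\<^esub> v \<in> T"
  using assms by (simp add: cayley_graph_def a_minus_def a_inv_def)

lemma pverts_cayley_graph [simp]: "pverts (cayley_graph (add_monoid R) T) = carrier R"
  by (simp add: cayley_graph_def)

lemma parcs_cayley_graph_subset:
  "parcs (cayley_graph A T) \<subseteq> pverts (cayley_graph A T) \<times> pverts (cayley_graph A T)"
  by (auto simp: cayley_graph_def)

lemma parcs_kronecker_family_subset: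
  "parcs (kronecker_family I \<Gamma>) \<subseteq> pverts (kronecker_family I \<Gamma>) \<times> pverts (kronecker_family I \<Gamma>)"
  by (auto simp: kronecker_family_def)


section \<open>Unit powers detected by a family of homomorphisms\<close>

text \<open>
  The family \<open>\<phi>\<close> is jointly surjective, with all joint fibres of size \<open>m\<close>, and it detects \<open>k\<close>-th
  powers of units. It serves twice: for the residue maps of \<open>R\<close>, and, with \<open>m = 1\<close>, for the
  projections of the reduced ring.
\<close>

locale power_detecting_family = ring R for R :: "('a, 'c) ring_scheme" (structure) +
  fixes I :: "'i set" and F :: "'i \<Rightarrow> ('b, 'd) ring_scheme"
    and \<phi> :: "'i \<Rightarrow> 'a \<Rightarrow> 'b" and k m :: nat
  assumes cring_F: "\<And>i. i \<in> I \<Longrightarrow> cring (F i)"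
    and hom: "\<And>i. i \<in> I \<Longrightarrow> ring_hom_ring R (F i) (\<phi> i)"
    and unit_powers_iff: "\<And>x. x \<in> carrier R \<Longrightarrow>
      x \<in> unit_powers R k \<longleftrightarrow> (\<forall>i\<in>I. \<phi> i x \<in> unit_powers (F i) k)"
    and fibres: "\<And>z. z \<in> (\<Pi>\<^sub>E i\<in>I. carrier (F i)) \<Longrightarrow>
      card {x \<in> carrier R. \<forall>i\<in>I. \<phi> i x = z i} = m"
    and m_pos: "m > 0"
begin

text \<open>
  This is the connection set that the Kronecker product of the graphs of the \<open>F i\<close> induces on \<open>R\<close>.
\<close>

definition componentwise_sym_powers :: "'a set" where
  "componentwise_sym_powers = {x \<in> carrier R. \<forall>i\<in>I. \<phi> i x \<in> sym_unit_powers (F i) k}"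

lemma ring_F: "i \<in> I \<Longrightarrow> ring (F i)"
  using cring_F by (simp add: cring.axioms(1))

lemma hom_closed: "i \<in> I \<Longrightarrow> x \<in> carrier R \<Longrightarrow> \<phi> i x \<in> carrier (F i)"
  using hom by (metis ring_hom_ring.homh ring_hom_closed)

lemma hom_uminus:
  assumes "i \<in> I" "x \<in> carrier R"
  shows "\<phi> i (\<ominus> x) = \<ominus>\<^bsub>F i\<^esub> \<phi> i x"
proof -
  interpret ring_hom_ring R "F i" "\<phi> i" using hom assms(1) .
  show ?thesis using assms(2) by simp
qed

lemma hom_minus:
  assumes "i \<in> I" "x \<in> carrier R" "y \<in> carrier R"
  shows "\<phi> i (x \<ominus> y) = \<phi> i x \<ominus>\<^bsub>F i\<^esub> \<phi> i y"
  using assms ring_hom_add[OF ring_hom_ring.homh[OF hom], of i x "\<ominus> y"]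
  by (simp add: a_minus_def hom_uminus)

lemma ex_preimage:
  assumes "\<And>i. i \<in> I \<Longrightarrow> z i \<in> carrier (F i)"
  obtains x where "x \<in> carrier R" "\<And>i. i \<in> I \<Longrightarrow> \<phi> i x = z i"
proof -
  have "card {x \<in> carrier R. \<forall>i\<in>I. \<phi> i x = restrict z I i} = m"
    using assms by (intro fibres) auto
  then have "{x \<in> carrier R. \<forall>i\<in>I. \<phi> i x = restrict z I i} \<noteq> {}"
    using m_pos by (metis card.empty less_nat_zero_code)
  then show ?thesis
    using that by auto
qed

text \<open>
  Differences are taken componentwise, so the joint map \<open>x \<mapsto> (\<phi> i x)\<close> preserves and reflects
  adjacency; its fibres have size \<open>m\<close>.
\<close>

lemma componentwise_cayley_iso_blow_up:
  "cayley_graph (add_monoid R) componentwise_sym_powers \<simeq>\<^sub>g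
    blow_up (kronecker_family I (\<lambda>i. unitary_cayley (F i) k)) m"
proof (rule graph_iso_blow_up_of_fibres[where \<Phi> = "\<lambda>x. \<lambda>i\<in>I. \<phi> i x"])
  fix u assume "u \<in> pverts (kronecker_family I (\<lambda>i. unitary_cayley (F i) k))"
  then have u: "u \<in> (\<Pi>\<^sub>E i\<in>I. carrier (F i))"
    by (simp add: kronecker_family_def unitary_cayley_def)
  have "(\<lambda>i\<in>I. \<phi> i x) = u \<longleftrightarrow> (\<forall>i\<in>I. \<phi> i x = u i)" for x
    using u by (auto simp: fun_eq_iff PiE_def extensional_def)
  then show "card {x \<in> pverts (cayley_graph (add_monoid R) componentwise_sym_powers).
      (\<lambda>i\<in>I. \<phi> i x) = u} = m"
    using fibres[OF u] by simp
next
  fix x y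
  assume "x \<in> pverts (cayley_graph (add_monoid R) componentwise_sym_powers)"
    and "y \<in> pverts (cayley_graph (add_monoid R) componentwise_sym_powers)"
  then have xy: "x \<in> carrier R" "y \<in> carrier R" by auto
  then show "(x, y) \<in> parcs (cayley_graph (add_monoid R) componentwise_sym_powers) \<longleftrightarrow>
     (\<lambda>i\<in>I. \<phi> i x, \<lambda>i\<in>I. \<phi> i y) \<in> parcs (kronecker_family I (\<lambda>i. unitary_cayley (F i) k))"
    using ring_axioms
    by (auto simp: parcs_cayley_add_monoid kronecker_family_def unitary_cayley_def ring_F hom_closed
        componentwise_sym_powers_def hom_minus)
next
  fix x assume "x \<in> pverts (cayley_graph (add_monoid R) componentwise_sym_powers)"
  then show "(\<lambda>i\<in>I. \<phi> i x) \<in> pverts (kronecker_family I (\<lambda>i. unitary_cayley (F i) k))"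
    by (simp add: kronecker_family_def unitary_cayley_def hom_closed)
qed (rule m_pos parcs_cayley_graph_subset parcs_kronecker_family_subset)+

lemma sym_unit_powers_subset: "sym_unit_powers R k \<subseteq> componentwise_sym_powers"
proof
  fix x assume x: "x \<in> sym_unit_powers R k"
  then have xR: "x \<in> carrier R"
    using unit_powers_closed by (auto simp: sym_unit_powers_def)
  then have "x \<in> unit_powers R k \<or> \<ominus> x \<in> unit_powers R k"
    using x by (simp add: sym_unit_powers_iff)
  then have "(\<forall>i\<in>I. \<phi> i x \<in> unit_powers (F i) k) \<or> (\<forall>i\<in>I. \<ominus>\<^bsub>F i\<^esub> \<phi> i x \<in> unit_powers (F i) k)"
    using unit_powers_iff xR hom_uminus by (metis a_inv_closed)
  then show "x \<in> componentwise_sym_powers"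
    using xR by (auto simp: componentwise_sym_powers_def ring.sym_unit_powers_iff ring_F hom_closed)
qed

text \<open>
  If \<open>-1\<close> is a \<open>k\<close>-th power in \<open>F i\<close>, then \<open>U_{F i,k}\<close> is symmetric and the \<open>i\<close>-th component accepts
  either sign. So the sign that works in the exceptional component, if there is one, works in all
  components, and \<open>x\<close> or \<open>- x\<close> is a \<open>k\<close>-th power of a unit.
\<close>

lemma sym_unit_powers_eq:
  assumes "\<exists>\<^sub>\<le>\<^sub>1 j. j \<in> I \<and> \<ominus>\<^bsub>F j\<^esub> \<one>\<^bsub>F j\<^esub> \<notin> unit_powers (F j) k"
  shows "sym_unit_powers R k = componentwise_sym_powers"
proof (intro equalityI sym_unit_powers_subset subsetI)
  fix x assume "x \<in> componentwise_sym_powers"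
  then have x: "x \<in> carrier R" and T: "\<And>i. i \<in> I \<Longrightarrow> \<phi> i x \<in> sym_unit_powers (F i) k"
    by (auto simp: componentwise_sym_powers_def)
  let ?U = "\<lambda>i. unit_powers (F i) k"
  have sign: "\<phi> i x \<in> ?U i \<or> \<ominus>\<^bsub>F i\<^esub> \<phi> i x \<in> ?U i" if "i \<in> I" for i
    using T[OF that] that x by (simp add: ring.sym_unit_powers_iff ring_F hom_closed)
  have both: "\<phi> i x \<in> ?U i \<and> \<ominus>\<^bsub>F i\<^esub> \<phi> i x \<in> ?U i"
    if "i \<in> I" "\<ominus>\<^bsub>F i\<^esub> \<one>\<^bsub>F i\<^esub> \<in> ?U i" for i
  proof -
    interpret Fi: cring "F i" using cring_F that(1) .
    show ?thesis
      using sign[OF that(1)] Fi.minus_in_unit_powers[OF that(2)] hom_closed[OF that(1) x]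
      by (metis Fi.minus_minus)
  qed
  have "x \<in> unit_powers R k \<or> \<ominus> x \<in> unit_powers R k"
  proof (cases "\<forall>i\<in>I. \<ominus>\<^bsub>F i\<^esub> \<one>\<^bsub>F i\<^esub> \<in> ?U i")
    case True
    then show ?thesis
      using both unit_powers_iff[OF x] by blast
  next
    case False
    then obtain j where j: "j \<in> I" "\<ominus>\<^bsub>F j\<^esub> \<one>\<^bsub>F j\<^esub> \<notin> ?U j" by blast
    then have others: "\<ominus>\<^bsub>F i\<^esub> \<one>\<^bsub>F i\<^esub> \<in> ?U i" if "i \<in> I" "i \<noteq> j" for i
      using assms[unfolded Uniq_def, rule_format, of i j] j that by blast
    show ?thesis
      using sign[OF j(1)]
    proof
      assume "\<phi> j x \<in> ?U j"
      then have "\<forall>i\<in>I. \<phi> i x \<in> ?U i" using both others by blast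
      then show ?thesis using unit_powers_iff[OF x] by blast
    next
      assume "\<ominus>\<^bsub>F j\<^esub> \<phi> j x \<in> ?U j"
      then have "\<forall>i\<in>I. \<ominus>\<^bsub>F i\<^esub> \<phi> i x \<in> ?U i" using both others by blast
      then have "\<forall>i\<in>I. \<phi> i (\<ominus> x) \<in> ?U i" using hom_uminus x by simp
      then show ?thesis using unit_powers_iff x by blast
    qed
  qed
  then show "x \<in> sym_unit_powers R k"
    using x by (simp add: sym_unit_powers_iff)
qed

text \<open>
  Two exceptional components \<open>j\<close> and \<open>l\<close> can be given opposite signs. The element with residue \<open>-1\<close>
  at \<open>l\<close> and \<open>1\<close> elsewhere does this: component \<open>l\<close> prevents it from being a \<open>k\<close>-th power, and
  component \<open>j\<close> does the same for its negative.
\<close>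

lemma sym_unit_powers_neq:
  assumes "j \<in> I" "l \<in> I" "j \<noteq> l"
    and "\<ominus>\<^bsub>F j\<^esub> \<one>\<^bsub>F j\<^esub> \<notin> unit_powers (F j) k" "\<ominus>\<^bsub>F l\<^esub> \<one>\<^bsub>F l\<^esub> \<notin> unit_powers (F l) k"
  obtains x where "x \<in> componentwise_sym_powers" "x \<notin> sym_unit_powers R k"
proof -
  let ?z = "\<lambda>i. if i = l then \<ominus>\<^bsub>F i\<^esub> \<one>\<^bsub>F i\<^esub> else \<one>\<^bsub>F i\<^esub>"
  have one: "\<one>\<^bsub>F i\<^esub> \<in> carrier (F i)" "\<ominus>\<^bsub>F i\<^esub> \<one>\<^bsub>F i\<^esub> \<in> carrier (F i)" if "i \<in> I" for i
    using ring_F[OF that] by (simp_all add: ring.ring_simprules)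
  obtain x where x: "x \<in> carrier R" and \<phi>x: "\<And>i. i \<in> I \<Longrightarrow> \<phi> i x = ?z i"
    using ex_preimage[of ?z] one by metis
  have "?z i \<in> sym_unit_powers (F i) k" if "i \<in> I" for i
    using ring.one_in_unit_powers[OF ring_F[OF that]] by (auto simp: sym_unit_powers_def)
  then have "x \<in> componentwise_sym_powers"
    using x \<phi>x by (simp add: componentwise_sym_powers_def)
  moreover have "x \<notin> unit_powers R k"
    using unit_powers_iff[OF x] \<phi>x[OF assms(2)] assms by auto
  moreover have "\<ominus> x \<notin> unit_powers R k"
    using unit_powers_iff[of "\<ominus> x"] \<phi>x[OF assms(1)] hom_uminus[OF assms(1) x] x assms by auto
  ultimately show ?thesis
    using that x by (simp add: sym_unit_powers_iff)
qed

text \<open>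
  The blow-up is isomorphic to the Cayley graph of the larger connection set. This reduces the
  failure of an isomorphism to a comparison of numbers of arcs, which separates the two graphs
  as soon as the connection sets differ.
\<close>

theorem unitary_cayley_iso_blow_up_iff:
  assumes "finite (carrier R)"
  shows "unitary_cayley R k \<simeq>\<^sub>g blow_up (kronecker_family I (\<lambda>i. unitary_cayley (F i) k)) m
    \<longleftrightarrow> (\<exists>\<^sub>\<le>\<^sub>1 j. j \<in> I \<and> \<ominus>\<^bsub>F j\<^esub> \<one>\<^bsub>F j\<^esub> \<notin> unit_powers (F j) k)"
proof
  assume "\<exists>\<^sub>\<le>\<^sub>1 j. j \<in> I \<and> \<ominus>\<^bsub>F j\<^esub> \<one>\<^bsub>F j\<^esub> \<notin> unit_powers (F j) k"
  then show "unitary_cayley R k \<simeq>\<^sub>g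
      blow_up (kronecker_family I (\<lambda>i. unitary_cayley (F i) k)) m"
    using componentwise_cayley_iso_blow_up sym_unit_powers_eq by (simp add: unitary_cayley_def)
next
  let ?X = "cayley_graph (add_monoid R) componentwise_sym_powers"
  let ?B = "blow_up (kronecker_family I (\<lambda>i. unitary_cayley (F i) k)) m"
  have B: "parcs ?B \<subseteq> pverts ?B \<times> pverts ?B"
    by (rule parcs_blow_up_subset[OF parcs_kronecker_family_subset])
  assume iso: "unitary_cayley R k \<simeq>\<^sub>g ?B"
  have card_eq: "card (parcs (unitary_cayley R k)) = card (parcs ?X)"
    using graph_iso_card_parcs[OF parcs_cayley_graph_subset B iso[unfolded unitary_cayley_def[of R]]]
      graph_iso_card_parcs[OF parcs_cayley_graph_subset B componentwise_cayley_iso_blow_up]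
    by (simp add: unitary_cayley_def[of R])
  show "\<exists>\<^sub>\<le>\<^sub>1 j. j \<in> I \<and> \<ominus>\<^bsub>F j\<^esub> \<one>\<^bsub>F j\<^esub> \<notin> unit_powers (F j) k"
  proof (rule Uniq_I, rule ccontr, elim conjE)
    fix j l assume "j \<in> I" "l \<in> I" "j \<noteq> l"
      "\<ominus>\<^bsub>F j\<^esub> \<one>\<^bsub>F j\<^esub> \<notin> unit_powers (F j) k" "\<ominus>\<^bsub>F l\<^esub> \<one>\<^bsub>F l\<^esub> \<notin> unit_powers (F l) k"
    then obtain x where x: "x \<in> componentwise_sym_powers" "x \<notin> sym_unit_powers R k"
      by (meson sym_unit_powers_neq)
    then have "x \<in> carrier R"
      by (simp add: componentwise_sym_powers_def)
    \<comment> \<open>An element that distinguishes the connection sets is a neighbour of \<open>0\<close> in only one graph.\<close>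
    then have "(\<zero>, x) \<in> parcs ?X" "(\<zero>, x) \<notin> parcs (unitary_cayley R k)"
      using x ring_axioms by (simp_all add: parcs_cayley_add_monoid unitary_cayley_def a_minus_def)
    moreover have "parcs (unitary_cayley R k) \<subseteq> parcs ?X"
      using sym_unit_powers_subset by (auto simp: unitary_cayley_def cayley_graph_def)
    moreover have "finite (parcs ?X)"
      using assms parcs_cayley_graph_subset[of "add_monoid R" componentwise_sym_powers]
      by (auto intro: finite_subset)
    ultimately have "card (parcs (unitary_cayley R k)) < card (parcs ?X)"
      by (intro psubset_card_mono) auto
    then show False
      using card_eq by simp
  qed
qed

end


section \<open>Finite local rings\<close>

text \<open>
  In a finite ring, a proper ideal containing \<open>x\<close> can be enlarged to a maximal one, which in the
  local case is \<open>M\<close>. So the principal ideal of an element outside \<open>M\<close> is the whole ring.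
\<close>

lemma finite_local_ring_Units:
  assumes "local_ring R" and "finite (carrier R)" and "maximalideal M R"
    and x: "x \<in> carrier R" "x \<notin> M"
  shows "x \<in> Units R"
proof -
  interpret cring R using assms(1) by (simp add: local_ring_def)
  have unique: "J = M" if "maximalideal J R" for J
    using that assms(1,3) by (auto simp: local_ring_def)
  have no_proper: "J = carrier R" if "ideal J R" "x \<in> J" for J
  proof (rule ccontr)
    assume ne: "J \<noteq> carrier R"
    define \<J> where "\<J> = {K. ideal K R \<and> x \<in> K \<and> K \<noteq> carrier R}"
    have "\<J> \<subseteq> Pow (carrier R)"
      by (auto simp: \<J>_def dest: ideal.Icarr)
    then have "finite \<J>" "J \<in> \<J>"
      using assms(2) that ne by (auto simp: \<J>_def intro: finite_subset)
    then obtain K where K: "K \<in> \<J>" and max: "\<And>L. L \<in> \<J> \<Longrightarrow> K \<subseteq> L \<Longrightarrow> L = K"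
      using finite_has_maximal2[of \<J> J] by metis
    have "maximalideal K R"
    proof (rule maximalidealI)
      fix L assume L: "ideal L R" "K \<subseteq> L" "L \<subseteq> carrier R"
      have "x \<in> L" using K L(2) by (auto simp: \<J>_def)
      then show "L = K \<or> L = carrier R"
        using L max[of L] by (auto simp: \<J>_def)
    qed (use K in \<open>auto simp: \<J>_def\<close>)
    then show False
      using unique K x(2) by (auto simp: \<J>_def)
  qed
  have "PIdl\<^bsub>R\<^esub> x = carrier R"
    using no_proper[OF cgenideal_ideal[OF x(1)] cgenideal_self[OF x(1)]] .
  then have "\<one>\<^bsub>R\<^esub> \<in> PIdl\<^bsub>R\<^esub> x" by simp
  then obtain y where "y \<in> carrier R" "y \<otimes>\<^bsub>R\<^esub> x = \<one>\<^bsub>R\<^esub>"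
    by (auto simp: cgenideal_def)
  then show ?thesis
    using x(1) m_comm[of x] unfolding Units_def by auto
qed

locale local_residue_map = ring_hom_ring R F \<pi>
  for R :: "('a, 'c) ring_scheme" and F :: "('b, 'd) ring_scheme" and \<pi> :: "'a \<Rightarrow> 'b" +
  fixes M :: "'a set"
  assumes local_R: "local_ring R" and finite_R: "finite (carrier R)"
    and field_F: "field F" and max_M: "maximalideal M R"
    and surj: "\<pi> ` carrier R = carrier F"
    and kernel: "{x \<in> carrier R. \<pi> x = \<zero>\<^bsub>F\<^esub>} = M"
begin

sublocale R: cring R
  using local_R by (simp add: local_ring_def)

sublocale F: field F
  by (rule field_F)

lemma mem_M_iff: "x \<in> M \<longleftrightarrow> x \<in> carrier R \<and> \<pi> x = \<zero>\<^bsub>F\<^esub>"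
  using kernel by auto

lemma finite_M: "finite M"
  using finite_R by (rule rev_finite_subset) (auto simp: mem_M_iff)

lemma zero_in_M: "\<zero>\<^bsub>R\<^esub> \<in> M"
  using kernel by auto

lemma card_M_pos: "card M > 0"
  using finite_M zero_in_M by (auto simp: card_gt_0_iff)

lemma card_M_dvd_order: "card M dvd order R"
proof -
  interpret maximalideal M R by (rule max_M)
  show ?thesis
    using R.a_lagrange[OF finite_R additive_subgroup_axioms] by (metis dvd_triv_right)
qed

lemma Units_iff: "x \<in> carrier R \<Longrightarrow> x \<in> Units R \<longleftrightarrow> \<pi> x \<noteq> \<zero>\<^bsub>F\<^esub>"
proof
  assume "x \<in> Units R"
  then have "\<pi> x \<in> Units F"
    by (rule ring_hom_Units[OF ring_hom_ring_axioms])
  then show "\<pi> x \<noteq> \<zero>\<^bsub>F\<^esub>"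
    by (simp add: F.field_Units)
next
  assume "x \<in> carrier R" "\<pi> x \<noteq> \<zero>\<^bsub>F\<^esub>"
  then show "x \<in> Units R"
    using kernel by (intro finite_local_ring_Units[OF local_R finite_R max_M]) auto
qed

lemma card_fibre:
  assumes "z \<in> carrier F"
  shows "card {x \<in> carrier R. \<pi> x = z} = card M"
proof -
  obtain y where y: "y \<in> carrier R" "\<pi> y = z"
    using assms unfolding surj[symmetric] by auto
  have "bij_betw (\<lambda>x. y \<oplus>\<^bsub>R\<^esub> x) M {x \<in> carrier R. \<pi> x = z}"
  proof (rule bij_betw_byWitness[where f' = "\<lambda>x. \<ominus>\<^bsub>R\<^esub> y \<oplus>\<^bsub>R\<^esub> x"])
    show "\<forall>x\<in>M. \<ominus>\<^bsub>R\<^esub> y \<oplus>\<^bsub>R\<^esub> (y \<oplus>\<^bsub>R\<^esub> x) = x"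
      using y by (simp add: mem_M_iff R.r_neg1)
    show "\<forall>x\<in>{x \<in> carrier R. \<pi> x = z}. y \<oplus>\<^bsub>R\<^esub> (\<ominus>\<^bsub>R\<^esub> y \<oplus>\<^bsub>R\<^esub> x) = x"
      using y by (simp add: R.r_neg2)
    show "(\<lambda>x. y \<oplus>\<^bsub>R\<^esub> x) ` M \<subseteq> {x \<in> carrier R. \<pi> x = z}"
      using y assms by (auto simp: mem_M_iff)
    show "(\<lambda>x. \<ominus>\<^bsub>R\<^esub> y \<oplus>\<^bsub>R\<^esub> x) ` {x \<in> carrier R. \<pi> x = z} \<subseteq> M"
      using y assms by (auto simp: mem_M_iff S.l_neg)
  qed
  then show ?thesis
    by (simp add: bij_betw_same_card)
qed

text \<open>
  The fibre of \<open>\<pi>\<close> over \<open>1\<close> is the coset \<open>1 + M\<close>, the group of one-units.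
\<close>

lemma one_units_subgroup:
  "subgroup {x \<in> carrier R. \<pi> x = \<one>\<^bsub>F\<^esub>} (units_of R)"
proof -
  interpret U: group "units_of R" by (rule R.units_group)
  show ?thesis
  proof (rule U.subgroupI)
    show sub: "{x \<in> carrier R. \<pi> x = \<one>\<^bsub>F\<^esub>} \<subseteq> carrier (units_of R)"
      by (auto simp: units_of_carrier Units_iff)
    show "{x \<in> carrier R. \<pi> x = \<one>\<^bsub>F\<^esub>} \<noteq> {}"
      using R.one_closed hom_one by blast
    fix x assume "x \<in> {x \<in> carrier R. \<pi> x = \<one>\<^bsub>F\<^esub>}"
    then have x: "x \<in> Units R" "\<pi> x = \<one>\<^bsub>F\<^esub>"
      using sub by (auto simp: units_of_carrier)
    then have "\<pi> (inv\<^bsub>R\<^esub> x \<otimes>\<^bsub>R\<^esub> x) = \<pi> (inv\<^bsub>R\<^esub> x)"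
      by (subst hom_mult) (auto simp: R.Units_closed)
    then have "\<pi> (inv\<^bsub>R\<^esub> x) = \<one>\<^bsub>F\<^esub>"
      using x by simp
    then show "inv\<^bsub>units_of R\<^esub> x \<in> {x \<in> carrier R. \<pi> x = \<one>\<^bsub>F\<^esub>}"
      using x by (simp add: R.units_of_inv)
  qed (auto simp: units_of_mult)
qed

text \<open>
  The group \<open>1 + M\<close> has order \<open>|M|\<close>, so raising to the \<open>k\<close>-th power on it is inverted by raising
  to the \<open>t\<close>-th power, where \<open>k t \<equiv> 1\<close> modulo \<open>|M|\<close>.
\<close>

lemma one_unit_is_power:
  assumes "coprime k (card M)" and x: "x \<in> carrier R" "\<pi> x = \<one>\<^bsub>F\<^esub>"
  obtains y where "y \<in> Units R" "y [^]\<^bsub>R\<^esub> k = x"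
proof -
  let ?H = "{x \<in> carrier R. \<pi> x = \<one>\<^bsub>F\<^esub>}" and ?n = "card M"
  have xU: "x \<in> Units R"
    using x by (simp add: Units_iff)
  have pow: "y [^]\<^bsub>(units_of R)\<lparr>carrier := ?H\<rparr>\<^esub> j = y [^]\<^bsub>R\<^esub> j" for y and j :: nat
    by (induction j) (auto simp: nat_pow_def units_of_def)
  have "group ((units_of R)\<lparr>carrier := ?H\<rparr>)"
    using one_units_subgroup R.units_group by (rule subgroup.subgroup_is_group)
  moreover have "order ((units_of R)\<lparr>carrier := ?H\<rparr>) = ?n"
    using card_fibre[of "\<one>\<^bsub>F\<^esub>"] by (simp add: order_def)
  ultimately have x_n: "x [^]\<^bsub>R\<^esub> ?n = \<one>\<^bsub>R\<^esub>"
    using group.pow_order_eq_1[of "(units_of R)\<lparr>carrier := ?H\<rparr>" x] x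
    by (simp add: pow) (simp add: units_of_def)
  obtain t where "[k * t = 1] (mod ?n)"
    using cong_solve_coprime_nat[OF assms(1)] by auto
  show ?thesis
  proof (rule that)
    show "x [^]\<^bsub>R\<^esub> t \<in> Units R"
      using xU by (rule R.Units_pow_closed)
    have "x [^]\<^bsub>R\<^esub> (j + ?n * r) = x [^]\<^bsub>R\<^esub> j" for j r :: nat
      using x x_n by (simp add: R.nat_pow_mult[symmetric] R.nat_pow_pow[symmetric])
    then have "x [^]\<^bsub>R\<^esub> (j mod ?n) = x [^]\<^bsub>R\<^esub> j" for j
      by (metis mod_mult_div_eq)
    then have "x [^]\<^bsub>R\<^esub> (k * t) = x [^]\<^bsub>R\<^esub> (1::nat)"
      using \<open>[k * t = 1] (mod ?n)\<close> by (metis cong_def)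
    then show "(x [^]\<^bsub>R\<^esub> t) [^]\<^bsub>R\<^esub> k = x"
      using x by (simp add: R.nat_pow_pow mult.commute)
  qed
qed

text \<open>
  A \<open>k\<close>-th root of the residue lifts to a unit \<open>y\<close> of \<open>R\<close>, and the error \<open>x / y^k\<close> is a one-unit,
  hence a \<open>k\<close>-th power.
\<close>

lemma unit_powers_iff:
  assumes "coprime k (card M)" and x: "x \<in> carrier R"
  shows "x \<in> unit_powers R k \<longleftrightarrow> \<pi> x \<in> unit_powers F k"
proof
  assume "\<pi> x \<in> unit_powers F k"
  then obtain z where z: "z \<in> Units F" "\<pi> x = z [^]\<^bsub>F\<^esub> k"
    by (auto simp: unit_powers_def)
  then have "z \<in> \<pi> ` carrier R"
    by (auto simp: surj)
  then obtain y where y: "y \<in> carrier R" "\<pi> y = z" by auto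
  have yU: "y \<in> Units R"
    using y z by (simp add: Units_iff F.field_Units)
  then have ykU: "y [^]\<^bsub>R\<^esub> k \<in> Units R"
    by (rule R.Units_pow_closed)
  let ?u = "inv\<^bsub>R\<^esub> (y [^]\<^bsub>R\<^esub> k) \<otimes>\<^bsub>R\<^esub> x"
  have "\<pi> x = \<pi> (y [^]\<^bsub>R\<^esub> k)"
    using y z by (simp add: ring_hom_pow[OF ring_hom_ring_axioms])
  then have "\<pi> ?u = \<pi> (inv\<^bsub>R\<^esub> (y [^]\<^bsub>R\<^esub> k)) \<otimes>\<^bsub>F\<^esub> \<pi> (y [^]\<^bsub>R\<^esub> k)"
    using x ykU by simp
  also have "\<dots> = \<pi> (inv\<^bsub>R\<^esub> (y [^]\<^bsub>R\<^esub> k) \<otimes>\<^bsub>R\<^esub> y [^]\<^bsub>R\<^esub> k)"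
    using y(1) ykU by (subst hom_mult) auto
  also have "\<dots> = \<one>\<^bsub>F\<^esub>"
    using ykU by (simp add: R.Units_l_inv)
  finally have "\<pi> ?u = \<one>\<^bsub>F\<^esub>" .
  then obtain w where w: "w \<in> Units R" "w [^]\<^bsub>R\<^esub> k = ?u"
    using one_unit_is_power[OF assms(1), of ?u] x ykU by auto
  have "(y \<otimes>\<^bsub>R\<^esub> w) [^]\<^bsub>R\<^esub> k = y [^]\<^bsub>R\<^esub> k \<otimes>\<^bsub>R\<^esub> ?u"
    using y w by (simp add: R.nat_pow_distrib R.Units_closed)
  also have "\<dots> = x"
    using x y ykU by (simp flip: R.m_assoc)
  finally show "x \<in> unit_powers R k"
    using yU w unfolding unit_powers_def by blast
qed (rule ring_hom_unit_powers[OF ring_hom_ring_axioms])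

end

lemma ex_local_residue_map:
  assumes "local_ring R" "finite (carrier R)" "maximalideal M R" "field F" "R Quot M \<simeq> F"
  obtains \<pi> where "local_residue_map R F \<pi> M"
proof -
  interpret cring R using assms(1) by (simp add: local_ring_def)
  interpret M: maximalideal M R by fact
  interpret F: field F by fact
  obtain g where g: "g \<in> ring_iso (R Quot M) F"
    using assms(5) by (auto simp: is_ring_iso_def)
  let ?\<pi> = "g \<circ> (\<lambda>x. M +>\<^bsub>R\<^esub> x)"
  have hom: "?\<pi> \<in> ring_hom R F"
    using ring_hom_trans[OF M.rcos_ring_hom] g by (auto simp: ring_iso_def)
  have Quot: "carrier (R Quot M) = (\<lambda>x. M +>\<^bsub>R\<^esub> x) ` carrier R"
    by (auto simp: FactRing_def A_RCOSETS_def')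
  have zero: "?\<pi> x = \<zero>\<^bsub>F\<^esub> \<longleftrightarrow> x \<in> M" if "x \<in> carrier R" for x
  proof -
    have "g M = \<zero>\<^bsub>F\<^esub>"
      using ring_hom_zero[of g "R Quot M" F] g M.quotient_is_ring F.ring_axioms
      by (simp add: ring_iso_def FactRing_def)
    moreover have "M \<in> carrier (R Quot M)"
      using M.quotient_is_ring ring.ring_simprules(2) by (force simp: FactRing_def)
    moreover have "M +>\<^bsub>R\<^esub> x \<in> carrier (R Quot M)"
      unfolding Quot using that by (rule imageI)
    moreover have "inj_on g (carrier (R Quot M))"
      using g by (simp add: ring_iso_def bij_betw_def)
    ultimately have "?\<pi> x = \<zero>\<^bsub>F\<^esub> \<longleftrightarrow> M +>\<^bsub>R\<^esub> x = M"
      by (metis comp_apply inj_on_eq_iff)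
    also have "\<dots> \<longleftrightarrow> x \<in> M"
      using M.rcos_const_imp_mem[OF that] M.a_rcos_const by metis
    finally show ?thesis .
  qed
  have "local_residue_map R F ?\<pi> M"
  proof (intro local_residue_map.intro local_residue_map_axioms.intro)
    show "ring_hom_ring R F ?\<pi>"
      using hom by (intro ring_hom_ringI2) (unfold_locales)
    show "?\<pi> ` carrier R = carrier F"
      using g unfolding image_comp[symmetric] Quot[symmetric] by (simp add: ring_iso_def bij_betw_def)
    show "{x \<in> carrier R. ?\<pi> x = \<zero>\<^bsub>F\<^esub>} = M"
      using zero M.Icarr by auto
  qed (use assms in auto)
  then show ?thesis by (rule that)
qed


section \<open>Finite products of rings\<close>

text \<open>
  A product of rings is described by its projections rather than by a carrier of tuples, so that
  an isomorphic copy of a product, such as the ring of an Artin decomposition, is again one.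
\<close>

locale ring_product = ring R for R :: "('a, 'c) ring_scheme" (structure) +
  fixes I :: "'i set" and S :: "'i \<Rightarrow> ('b, 'd) ring_scheme" and p :: "'i \<Rightarrow> 'a \<Rightarrow> 'b"
  assumes proj_hom: "\<And>i. i \<in> I \<Longrightarrow> ring_hom_ring R (S i) (p i)"
    and bij: "bij_betw (\<lambda>x. \<lambda>i\<in>I. p i x) (carrier R) (\<Pi>\<^sub>E i\<in>I. carrier (S i))"
begin

lemma proj_closed: "i \<in> I \<Longrightarrow> x \<in> carrier R \<Longrightarrow> p i x \<in> carrier (S i)"
  using proj_hom by (metis ring_hom_ring.homh ring_hom_closed)

lemma eqI:
  assumes "x \<in> carrier R" "y \<in> carrier R" "\<And>i. i \<in> I \<Longrightarrow> p i x = p i y"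
  shows "x = y"
  using assms bij_betw_imp_inj_on[OF bij] by (auto simp: inj_on_def intro!: restrict_ext)

lemma ex_tuple:
  assumes "\<And>i. i \<in> I \<Longrightarrow> y i \<in> carrier (S i)"
  obtains x where "x \<in> carrier R" "\<And>i. i \<in> I \<Longrightarrow> p i x = y i"
proof -
  have "restrict y I \<in> (\<lambda>x. \<lambda>i\<in>I. p i x) ` carrier R"
    using assms bij_betw_imp_surj_on[OF bij] by auto
  then obtain x where "x \<in> carrier R" "(\<lambda>i\<in>I. p i x) = restrict y I" by auto
  then show ?thesis
    using that by (metis restrict_apply')
qed

text \<open>
  This yields both the order of the product and the size of the joint fibres of maps on the factors.
\<close>

lemma card_box:
  assumes "\<And>i. i \<in> I \<Longrightarrow> B i \<subseteq> carrier (S i)" and "finite I"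
  shows "card {x \<in> carrier R. \<forall>i\<in>I. p i x \<in> B i} = (\<Prod>i\<in>I. card (B i))"
proof -
  have "bij_betw (\<lambda>x. \<lambda>i\<in>I. p i x) {x \<in> carrier R. \<forall>i\<in>I. p i x \<in> B i} (\<Pi>\<^sub>E i\<in>I. B i)"
  proof (rule bij_betw_subset[OF bij])
    show "(\<lambda>x. \<lambda>i\<in>I. p i x) ` {x \<in> carrier R. \<forall>i\<in>I. p i x \<in> B i} = (\<Pi>\<^sub>E i\<in>I. B i)"
    proof (intro equalityI subsetI)
      fix y assume y: "y \<in> (\<Pi>\<^sub>E i\<in>I. B i)"
      then obtain x where "x \<in> carrier R" "\<And>i. i \<in> I \<Longrightarrow> p i x = y i"
        using ex_tuple[of y] assms(1) by blast
      with y show "y \<in> (\<lambda>x. \<lambda>i\<in>I. p i x) ` {x \<in> carrier R. \<forall>i\<in>I. p i x \<in> B i}"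
        by (intro image_eqI[of _ _ x]) (auto simp: fun_eq_iff PiE_def extensional_def)
    qed auto
  qed auto
  then show ?thesis
    by (simp add: bij_betw_same_card card_PiE assms(2))
qed

lemma order_eq: "finite I \<Longrightarrow> order R = (\<Prod>i\<in>I. order (S i))"
  using card_box[of "\<lambda>i. carrier (S i)"] proj_closed by (simp add: order_def cong: conj_cong)

lemma finite_factor:
  assumes "finite (carrier R)" "i \<in> I"
  shows "finite (carrier (S i))"
proof -
  have "carrier (S i) \<subseteq> p i ` carrier R"
  proof
    fix y assume "y \<in> carrier (S i)"
    moreover have "\<zero>\<^bsub>S j\<^esub> \<in> carrier (S j)" if "j \<in> I" for j
      using that proj_hom by (metis proj_closed[OF that] ring_hom_zero ring_hom_ring.homh
          ring_hom_ring.axioms(1,2) zero_closed)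
    ultimately obtain x where "x \<in> carrier R" "\<And>j. j \<in> I \<Longrightarrow> p j x = (if j = i then y else \<zero>\<^bsub>S j\<^esub>)"
      using ex_tuple[of "\<lambda>j. if j = i then y else \<zero>\<^bsub>S j\<^esub>"] by metis
    then show "y \<in> p i ` carrier R"
      using assms(2) by force
  qed
  then show ?thesis
    using assms(1) by (meson finite_imageI finite_subset)
qed

lemma Units_tuple:
  assumes x: "x \<in> carrier R" and units: "\<And>i. i \<in> I \<Longrightarrow> p i x \<in> Units (S i)"
  shows "x \<in> Units R"
proof -
  have ringS: "ring (S i)" if "i \<in> I" for i
    using proj_hom[OF that] by (simp add: ring_hom_ring_def)
  have monS: "monoid (S i)" if "i \<in> I" for i
    using ringS[OF that] by (simp add: ring_def)
  obtain y where y: "y \<in> carrier R" "\<And>i. i \<in> I \<Longrightarrow> p i y = inv\<^bsub>S i\<^esub> p i x"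
    using ex_tuple[of "\<lambda>i. inv\<^bsub>S i\<^esub> p i x"] units monS
    by (metis monoid.Units_inv_closed)
  have "p i (x \<otimes> y) = p i \<one> \<and> p i (y \<otimes> x) = p i \<one>" if i: "i \<in> I" for i
  proof -
    interpret ring_hom_ring R "S i" "p i" using proj_hom[OF i] .
    show ?thesis
      using x y(1) y(2)[OF i] units[OF i] by simp
  qed
  then have "x \<otimes> y = \<one>" "y \<otimes> x = \<one>"
    using x y by (auto intro: eqI)
  then show ?thesis
    using x y by (auto simp: Units_def)
qed

lemma unit_powers_iff:
  assumes x: "x \<in> carrier R"
  shows "x \<in> unit_powers R k \<longleftrightarrow> (\<forall>i\<in>I. p i x \<in> unit_powers (S i) k)"
proof
  assume "\<forall>i\<in>I. p i x \<in> unit_powers (S i) k"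
  then obtain y where y: "\<And>i. i \<in> I \<Longrightarrow> y i \<in> Units (S i) \<and> p i x = y i [^]\<^bsub>S i\<^esub> k"
    unfolding unit_powers_def by simp metis
  then obtain w where w: "w \<in> carrier R" "\<And>i. i \<in> I \<Longrightarrow> p i w = y i"
    using ex_tuple[of y] by (auto simp: Units_def)
  have "w \<in> Units R"
    using w y by (auto intro: Units_tuple)
  moreover have "w [^] k = x"
    using w y x by (intro eqI) (auto simp: ring_hom_pow[OF proj_hom])
  ultimately show "x \<in> unit_powers R k"
    by (auto simp: unit_powers_def)
qed (auto intro: ring_hom_unit_powers[OF proj_hom])

end

lemma RDirProd_list_Cons:
  assumes "x \<in> carrier R" "y \<in> carrier R"
    and "xs \<in> carrier (RDirProd_list Rs)" "ys \<in> carrier (RDirProd_list Rs)"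
  shows "(x # xs) \<otimes>\<^bsub>RDirProd_list (R # Rs)\<^esub> (y # ys)
      = (x \<otimes>\<^bsub>R\<^esub> y) # (xs \<otimes>\<^bsub>RDirProd_list Rs\<^esub> ys)"
    and "(x # xs) \<oplus>\<^bsub>RDirProd_list (R # Rs)\<^esub> (y # ys)
      = (x \<oplus>\<^bsub>R\<^esub> y) # (xs \<oplus>\<^bsub>RDirProd_list Rs\<^esub> ys)"
  using ring_hom_mult[OF RDirProd_list_hom1[of R Rs], of "(x, xs)" "(y, ys)"]
    ring_hom_add[OF RDirProd_list_hom1[of R Rs], of "(x, xs)" "(y, ys)"] assms
  by (simp_all add: RDirProd_carrier) (simp_all add: RDirProd_def DirProd_def monoid.defs)

lemma RDirProd_list_nth:
  assumes "xs \<in> carrier (RDirProd_list Rs)" "ys \<in> carrier (RDirProd_list Rs)" "i < length Rs"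
  shows "(xs \<otimes>\<^bsub>RDirProd_list Rs\<^esub> ys) ! i = xs ! i \<otimes>\<^bsub>Rs ! i\<^esub> ys ! i"
    and "(xs \<oplus>\<^bsub>RDirProd_list Rs\<^esub> ys) ! i = xs ! i \<oplus>\<^bsub>Rs ! i\<^esub> ys ! i"
    and "\<one>\<^bsub>RDirProd_list Rs\<^esub> ! i = \<one>\<^bsub>Rs ! i\<^esub>"
  using assms
proof (induction Rs arbitrary: xs ys i)
  case (Cons R Rs)
  {
    case 1
    then show ?case
      using Cons.IH(1) by (cases i) (auto simp: RDirProd_list_carrier RDirProd_list_Cons)
  next
    case 2
    then show ?case
      using Cons.IH(2) by (cases i) (auto simp: RDirProd_list_carrier RDirProd_list_Cons)
  next
    case 3
    then show ?case
      using Cons.IH(3) by (cases i) (auto simp: RDirProd_list_carrier RDirProd_list_one)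
  }
qed auto

lemma ring_product_RDirProd_list:
  fixes S :: "nat \<Rightarrow> ('a, 'c) ring_scheme"
  assumes "\<And>i. i \<in> {1..s} \<Longrightarrow> ring (S i)"
  shows "ring_product (RDirProd_list (map S [1..<s + 1])) {1..s} S (\<lambda>i xs. xs ! (i - 1))"
proof -
  let ?L = "map S [1..<s + 1]"
  have nth: "?L ! (i - 1) = S i" "i - 1 < length ?L" if "i \<in> {1..s}" for i
    using that by (auto simp del: upt_Suc simp: nth_upt)
  have nth': "?L ! i = S (i + 1)" "i + 1 \<in> {1..s}" if "i < length ?L" for i
    using that by (auto simp del: upt_Suc simp: nth_upt)
  interpret L: ring "RDirProd_list ?L"
    using assms nth' by (intro RDirProd_list_is_ring) metis
  show ?thesis
  proof (intro ring_product.intro ring_product_axioms.intro)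
    fix i assume i: "i \<in> {1..s}"
    show "ring_hom_ring (RDirProd_list ?L) (S i) (\<lambda>xs. xs ! (i - 1))"
    proof (rule ring_hom_ringI2)
      show "(\<lambda>xs. xs ! (i - 1)) \<in> ring_hom (RDirProd_list ?L) (S i)"
        using nth[OF i] RDirProd_list_nth[of _ ?L _ "i - 1"] RDirProd_list_carrier_mem(2)[of _ ?L "i - 1"]
        by (intro ring_hom_memI) (metis L.one_closed)+
    qed (use assms i L.ring_axioms in auto)
  next
    show "bij_betw (\<lambda>xs. \<lambda>i\<in>{1..s}. xs ! (i - 1)) (carrier (RDirProd_list ?L))
        (\<Pi>\<^sub>E i\<in>{1..s}. carrier (S i))"
    proof (rule bij_betw_byWitness[where f' = "\<lambda>z. map z [1..<s + 1]"])
      show "\<forall>xs\<in>carrier (RDirProd_list ?L).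
          map (\<lambda>i\<in>{1..s}. xs ! (i - 1)) [1..<s + 1] = xs"
        using RDirProd_list_carrier_mem(1)[of _ ?L]
        by (auto intro!: nth_equalityI simp del: upt_Suc simp: nth_upt)
      show "\<forall>z\<in>\<Pi>\<^sub>E i\<in>{1..s}. carrier (S i). (\<lambda>i\<in>{1..s}. map z [1..<s + 1] ! (i - 1)) = z"
        by (auto simp del: upt_Suc simp: nth_upt fun_eq_iff PiE_def extensional_def)
      show "(\<lambda>xs. \<lambda>i\<in>{1..s}. xs ! (i - 1)) ` carrier (RDirProd_list ?L)
          \<subseteq> (\<Pi>\<^sub>E i\<in>{1..s}. carrier (S i))"
      proof (rule image_subsetI)
        fix xs assume xs: "xs \<in> carrier (RDirProd_list ?L)"
        have "xs ! (i - 1) \<in> carrier (S i)" if "i \<in> {1..s}" for i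
          using RDirProd_list_carrier_mem(2)[OF xs nth(2)[OF that]] unfolding nth(1)[OF that] .
        then show "(\<lambda>i\<in>{1..s}. xs ! (i - 1)) \<in> (\<Pi>\<^sub>E i\<in>{1..s}. carrier (S i))"
          by (simp add: restrict_PiE_iff)
      qed
      show "(\<lambda>z. map z [1..<s + 1]) ` (\<Pi>\<^sub>E i\<in>{1..s}. carrier (S i))
          \<subseteq> carrier (RDirProd_list ?L)"
        using nth' by (auto intro!: RDirProd_list_carrier_memI simp del: upt_Suc simp: nth_upt)
    qed
  qed (rule L.ring_axioms)
qed

lemma ring_product_transport:
  assumes "ring_product P I S p" and "ring R" and h: "h \<in> ring_iso R P"
  shows "ring_product R I S (\<lambda>i. p i \<circ> h)"
proof -
  interpret P: ring_product P I S p by fact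
  interpret R: ring R by fact
  have "ring_hom_ring R (S i) (p i \<circ> h)" if "i \<in> I" for i
  proof (rule ring_hom_ringI2)
    show "p i \<circ> h \<in> ring_hom R (S i)"
      using h P.proj_hom[OF that] by (intro ring_hom_trans) (auto simp: ring_iso_def ring_hom_ring.homh)
  qed (use P.proj_hom[OF that] R.ring_axioms in \<open>auto simp: ring_hom_ring_def\<close>)
  moreover have "bij_betw ((\<lambda>x. \<lambda>i\<in>I. p i x) \<circ> h) (carrier R) (\<Pi>\<^sub>E i\<in>I. carrier (S i))"
    using h P.bij by (intro bij_betw_trans) (auto simp: ring_iso_def)
  ultimately show ?thesis
    using R.ring_axioms by (simp add: ring_product_def ring_product_axioms_def comp_def)
qed

text \<open>
  A joint fibre of the residue maps is a product of fibres in the local factors, each of which is a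
  translate of the maximal ideal.
\<close>

lemma (in ring_product) power_detecting_residues:
  assumes "finite I" and res: "\<And>i. i \<in> I \<Longrightarrow> local_residue_map (S i) (F i) (\<pi> i) (M i)"
    and coprime: "\<And>i. i \<in> I \<Longrightarrow> coprime k (card (M i))"
  shows "power_detecting_family R I F (\<lambda>i. \<pi> i \<circ> p i) k (\<Prod>i\<in>I. card (M i))"
proof (intro power_detecting_family.intro power_detecting_family_axioms.intro)
  show "ring R" by (rule ring_axioms)
next
  fix i assume i: "i \<in> I"
  interpret local_residue_map "S i" "F i" "\<pi> i" "M i" using res[OF i] .
  show "cring (F i)" by (rule F.is_cring)
  show "ring_hom_ring R (F i) (\<pi> i \<circ> p i)"
    by (intro ring_hom_ringI2 ring_hom_trans[OF ring_hom_ring.homh[OF proj_hom[OF i]] homh]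
        ring_product.axioms(1)[OF ring_product_axioms] S.ring_axioms)
next
  fix x assume "x \<in> carrier R"
  then show "x \<in> unit_powers R k \<longleftrightarrow> (\<forall>i\<in>I. (\<pi> i \<circ> p i) x \<in> unit_powers (F i) k)"
    using local_residue_map.unit_powers_iff[OF res coprime] proj_closed
    by (simp add: unit_powers_iff)
next
  fix z assume z: "z \<in> (\<Pi>\<^sub>E i\<in>I. carrier (F i))"
  have "{x \<in> carrier R. \<forall>i\<in>I. (\<pi> i \<circ> p i) x = z i}
      = {x \<in> carrier R. \<forall>i\<in>I. p i x \<in> {y \<in> carrier (S i). \<pi> i y = z i}}"
    using proj_closed by auto
  then have "card {x \<in> carrier R. \<forall>i\<in>I. (\<pi> i \<circ> p i) x = z i}
      = (\<Prod>i\<in>I. card {y \<in> carrier (S i). \<pi> i y = z i})"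
    using card_box[of "\<lambda>i. {y \<in> carrier (S i). \<pi> i y = z i}"] assms(1) by simp
  also have "\<dots> = (\<Prod>i\<in>I. card (M i))"
    using z by (intro prod.cong refl local_residue_map.card_fibre[OF res]) auto
  finally show "card {x \<in> carrier R. \<forall>i\<in>I. (\<pi> i \<circ> p i) x = z i} = (\<Prod>i\<in>I. card (M i))" .
next
  show "(\<Prod>i\<in>I. card (M i)) > 0"
    using local_residue_map.card_M_pos[OF res] by (auto intro: prod_pos)
qed

lemma (in ring_product) power_detecting_projections:
  assumes "finite I" and "\<And>i. i \<in> I \<Longrightarrow> cring (S i)"
  shows "power_detecting_family R I S p k 1"
proof (intro power_detecting_family.intro power_detecting_family_axioms.intro)
  fix z assume z: "z \<in> (\<Pi>\<^sub>E i\<in>I. carrier (S i))"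
  then show "card {x \<in> carrier R. \<forall>i\<in>I. p i x = z i} = 1"
    using card_box[of "\<lambda>i. {z i}"] assms(1) by (auto simp: PiE_def Pi_def)
qed (use assms(2) proj_hom unit_powers_iff ring_axioms in auto)


section \<open>Artin decomposition and reduction\<close>

theorem theorem7p6:
  fixes R :: "'r ring" and Rs :: "nat \<Rightarrow> 'a ring" and F :: "nat \<Rightarrow> 'f ring"
    and \<mm> :: "nat \<Rightarrow> 'a set" and q :: "nat \<Rightarrow> nat" and s k m :: nat
    and R_red :: "'f list ring"
  assumes "cring R" and "finite (carrier R)"
    and "\<And>i. i \<in> {1..s} \<Longrightarrow> local_ring (Rs i)"
    and "\<And>i. i \<in> {1..s} \<Longrightarrow> maximalideal (\<mm> i) (Rs i)"
    and "\<And>i. i \<in> {1..s} \<Longrightarrow> field (F i)"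
    and "\<And>i. i \<in> {1..s} \<Longrightarrow> order (F i) = q i"
    and "\<And>i. i \<in> {1..s} \<Longrightarrow> Rs i Quot \<mm> i \<simeq> F i"
    and "R \<simeq> RDirProd_list (map Rs [1..<s + 1])"
    and "k > 0" and "gcd k (order R) = 1"
    and "R_red = RDirProd_list (map F [1..<s + 1])"
    and "m = (\<Prod>i\<in>{1..s}. card (\<mm> i))"
  shows "(unitary_cayley R k \<simeq>\<^sub>g
            kronecker_family {1..s} (\<lambda>i. unitary_cayley (F i) k) \<otimes>\<^sub>g add_loops (complete_graph m)
          \<and> kronecker_family {1..s} (\<lambda>i. unitary_cayley (F i) k) \<otimes>\<^sub>g add_loops (complete_graph m)
            \<simeq>\<^sub>g unitary_cayley R_red k \<otimes>\<^sub>g add_loops (complete_graph m)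
          \<and> unitary_cayley R_red k \<otimes>\<^sub>g add_loops (complete_graph m)
            \<simeq>\<^sub>g blow_up (unitary_cayley R_red k) m)
         \<longleftrightarrow> (\<exists>\<^sub>\<le>\<^sub>1 j. j \<in> {1..s} \<and> \<ominus>\<^bsub>Rs j\<^esub> \<one>\<^bsub>Rs j\<^esub> \<notin> unit_powers (Rs j) k)"
proof -
  let ?I = "{1..s}"
  let ?P = "kronecker_family ?I (\<lambda>i. unitary_cayley (F i) k)"
  let ?unique = "\<exists>\<^sub>\<le>\<^sub>1 j. j \<in> ?I \<and> \<ominus>\<^bsub>F j\<^esub> \<one>\<^bsub>F j\<^esub> \<notin> unit_powers (F j) k"
  have ring_R: "ring R" and ring_Rs: "\<And>i. i \<in> ?I \<Longrightarrow> ring (Rs i)"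
    and cring_F: "\<And>i. i \<in> ?I \<Longrightarrow> cring (F i)"
    using assms(1,3,5) by (auto simp: local_ring_def cring_def field_def domain_def)
  obtain h where "h \<in> ring_iso R (RDirProd_list (map Rs [1..<s + 1]))"
    using assms(8) by (auto simp: is_ring_iso_def)
  then interpret R: ring_product R ?I Rs "\<lambda>i. (\<lambda>xs. xs ! (i - 1)) \<circ> h"
    using ring_product_transport[OF ring_product_RDirProd_list[OF ring_Rs] ring_R] by auto
  have "\<exists>\<pi>. local_residue_map (Rs i) (F i) \<pi> (\<mm> i)" if "i \<in> ?I" for i
    using ex_local_residue_map[OF assms(3)[OF that] R.finite_factor[OF assms(2) that] assms(4)[OF that]
        assms(5)[OF that] assms(7)[OF that]] by metis
  then obtain \<pi> where \<pi>: "\<And>i. i \<in> ?I \<Longrightarrow> local_residue_map (Rs i) (F i) (\<pi> i) (\<mm> i)"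
    by metis
  have coprime: "coprime k (card (\<mm> i))" if "i \<in> ?I" for i
  proof -
    have "order (Rs i) dvd order R"
      unfolding R.order_eq[OF finite_atLeastAtMost] using that by (intro dvd_prodI) auto
    then have "card (\<mm> i) dvd order R"
      using local_residue_map.card_M_dvd_order[OF \<pi>[OF that]] dvd_trans by blast
    moreover have "coprime k (order R)"
      using assms(10) by (simp add: coprime_iff_gcd_eq_1)
    ultimately show ?thesis
      by (rule coprime_divisors[OF dvd_refl])
  qed
  interpret res: power_detecting_family R ?I F "\<lambda>i. \<pi> i \<circ> ((\<lambda>xs. xs ! (i - 1)) \<circ> h)" k m
    unfolding assms(12) using R.power_detecting_residues[OF _ \<pi> coprime] by simp
  interpret red: power_detecting_family R_red ?I F "\<lambda>i xs. xs ! (i - 1)" k 1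
    unfolding assms(11)
    using ring_product.power_detecting_projections[OF ring_product_RDirProd_list] cring_F
    by (metis cring.axioms(1) finite_atLeastAtMost)
  \<comment> \<open>The exceptional indices are the same for the local rings and for their residue fields.\<close>
  have minus_one_iff: "\<ominus>\<^bsub>Rs i\<^esub> \<one>\<^bsub>Rs i\<^esub> \<in> unit_powers (Rs i) k \<longleftrightarrow>
      \<ominus>\<^bsub>F i\<^esub> \<one>\<^bsub>F i\<^esub> \<in> unit_powers (F i) k" if "i \<in> ?I" for i
  proof -
    interpret loc: local_residue_map "Rs i" "F i" "\<pi> i" "\<mm> i" using \<pi>[OF that] .
    show ?thesis
      using loc.unit_powers_iff[OF coprime[OF that], of "\<ominus>\<^bsub>Rs i\<^esub> \<one>\<^bsub>Rs i\<^esub>"] by simp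
  qed
  \<comment> \<open>The projections of the reduced ring have joint fibres of size \<open>1\<close>: its graph is the Kronecker
    product itself, and blowing up preserves this isomorphism.\<close>
  have red_iso: "blow_up ?P m \<simeq>\<^sub>g blow_up (unitary_cayley R_red k) m" if ?unique
  proof -
    have P: "parcs ?P \<subseteq> pverts ?P \<times> pverts ?P"
      by (rule parcs_kronecker_family_subset)
    have G: "parcs (unitary_cayley R_red k) \<subseteq>
        pverts (unitary_cayley R_red k) \<times> pverts (unitary_cayley R_red k)"
      unfolding unitary_cayley_def by (rule parcs_cayley_graph_subset)
    have "unitary_cayley R_red k \<simeq>\<^sub>g blow_up ?P 1"
      using red.componentwise_cayley_iso_blow_up red.sym_unit_powers_eq[OF that]
      by (simp add: unitary_cayley_def)
    then have "?P \<simeq>\<^sub>g unitary_cayley R_red k"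
      using digraph_iso_trans blow_up_one_iso[OF P] graph_iso_sym[OF G] by blast
    then show ?thesis
      by (rule blow_up_cong[OF P G])
  qed
  have blow_up_refl: "blow_up (unitary_cayley R_red k) m \<simeq>\<^sub>g blow_up (unitary_cayley R_red k) m"
    by (intro graph_iso_refl parcs_blow_up_subset)
      (simp add: unitary_cayley_def parcs_cayley_graph_subset)
  have "?unique \<longleftrightarrow> (\<exists>\<^sub>\<le>\<^sub>1 j. j \<in> ?I \<and> \<ominus>\<^bsub>Rs j\<^esub> \<one>\<^bsub>Rs j\<^esub> \<notin> unit_powers (Rs j) k)"
    using minus_one_iff by (simp cong: conj_cong)
  then show ?thesis
    unfolding kronecker_looped_complete_eq_blow_up
    using res.unitary_cayley_iso_blow_up_iff[OF assms(2)] red_iso blow_up_refl by blast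
qed

end
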